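(* Fix an integer $m\ge1$. For every $n\ge2$ and every $p,q\in B_m$, \[ T_{p,q}^{(m)}(n)=\sum_{k=1}^{\min(m,n-1)} c_{k,p}\,T_{m-k,\,q-k}^{(m)}(n-k)+T_{p-1,\,m-1}^{(m)}(n-1), \] where $\infty-r=\infty$ for every integer $r\ge0$ and any term with a negative (finite) threshold is interpreted as zero. In particular, for $n\ge m+1$, \[ T_{p,q}^{(m)}(n)=\sum_{k=1}^{m} c_{k,p}\,T_{m-k,\,q-k}^{(m)}(n-k)+T_{p-1,\,m-1}^{(m)}(n-1). \]
   Context: A permutation $\pi=\pi_1\cdots\pi_n\in S_n$ contains the pattern $132$ if there are indices $i<j<k$ with $\pi_i<\pi_k<\pi_j$, and avoids $132$ otherwise; $\operatorname{Av}_n(132)$ denotes the set of $132$-avoiding permutations in $S_n$. For a fixed integer $m\ge1$, let $\mathcal A_n^{(m)}$ be the set of $\pi\in\operatorname{Av}_n(132)$ with $|\pi_{i+1}-\pi_i|\le m$ for all $1\le i<n$. Let $B_m=\{0,1,\ldots,m-1,\infty\}$. For $u,v\in\mathbb Z\cup\{\infty\}$ and $n\ge1$, let $T_{u,v}^{(m)}(n)$ be the number of $\pi\in\mathcal A_n^{(m)}$ with $n-\pi_1\le u$ and $n-\pi_n\le v$, where an inequality with threshold $\infty$ is vacuous (so $T_{u,v}^{(m)}(n)=0$ if $u<0$ or $v<0$). For $1\le k\le m$ and $p\in B_m$, set $c_{1,p}=1$ and, for $k\ge2$, $c_{k,p}=|\{\sigma\in\operatorname{Av}_{k-1}(132): k-\sigma_1\le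 p\}|$ (vacuous condition if $p=\infty$). *)

theory Defs
  imports
    "HOL-Library.Extended"
    "HOL-Combinatorics.Multiset_Permutations"
begin

text \<open>
  A permutation \<open>\<pi>\<close> of \<open>{1..n}\<close> is given by its one-line notation, a list in
  \<^term>\<open>permutations_of_set {1..n}\<close>.  List positions start at \<open>0\<close>, so the entry
  \<open>\<pi>\<^sub>i\<close> is \<open>\<pi> ! (i - 1)\<close>, with first entry \<open>hd \<pi>\<close> and last entry \<open>last \<pi>\<close>.
\<close>

definition contains_132 :: "nat list \<Rightarrow> bool" where
  "contains_132 \<pi> \<longleftrightarrow>
     (\<exists>i j k. i < j \<and> j < k \<and> k < length \<pi> \<and> \<pi> ! i < \<pi> ! k \<and> \<pi> ! k < \<pi> ! j)"

definition Av132 :: "nat \<Rightarrow> nat list set" where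
  "Av132 n = {\<pi> \<in> permutations_of_set {1..n}. \<not> contains_132 \<pi>}"

definition bounded_Av132 :: "nat \<Rightarrow> nat \<Rightarrow> nat list set" where
  "bounded_Av132 m n =
     {\<pi> \<in> Av132 n. \<forall>i. Suc i < n \<longrightarrow> \<bar>int (\<pi> ! Suc i) - int (\<pi> ! i)\<bar> \<le> int m}"

text \<open>
  Thresholds in \<open>\<int> \<union> {\<infinity>}\<close> are elements of \<^typ>\<open>int extended\<close>; the additional element
  \<open>-\<infinity>\<close> of that type never arises from \<open>B m\<close> by subtracting integers.
\<close>

definition B :: "nat \<Rightarrow> int extended set" where
  "B m = insert \<infinity> (Fin ` {0..<int m})"

definition T :: "nat \<Rightarrow> int extended \<Rightarrow> int extended \<Rightarrow> nat \<Rightarrow> nat" where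
  "T m u v n = card {\<pi> \<in> bounded_Av132 m n.
     Fin (int n - int (hd \<pi>)) \<le> u \<and> Fin (int n - int (last \<pi>)) \<le> v}"

definition c :: "nat \<Rightarrow> int extended \<Rightarrow> nat" where
  "c k p = (if k = 1 then 1
            else card {\<sigma> \<in> Av132 (k - 1). Fin (int k - int (hd \<sigma>)) \<le> p})"

text \<open>Terms with a negative threshold vanish by the definition of \<open>T\<close>.\<close>

lemma T_negative_threshold:
  assumes "n \<ge> 1" and "u < 0 \<or> v < 0"
  shows "T m u v n = 0"
proof -
  have "\<not> (Fin (int n - int (hd \<pi>)) \<le> u \<and> Fin (int n - int (last \<pi>)) \<le> v)"
    if "\<pi> \<in> bounded_Av132 m n" for \<pi>
  proof -
    have s: "set \<pi> = {1..n}"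
      using that by (auto simp: bounded_Av132_def Av132_def permutations_of_set_def)
    then have "\<pi> \<noteq> []" using assms(1) by auto
    then have "hd \<pi> \<in> set \<pi>" "last \<pi> \<in> set \<pi>" by auto
    then have "0 \<le> int n - int (hd \<pi>)" "0 \<le> int n - int (last \<pi>)"
      unfolding s by auto
    then have "0 \<le> Fin (int n - int (hd \<pi>))" "0 \<le> Fin (int n - int (last \<pi>))"
      by (simp_all add: zero_extended_def)
    then show ?thesis using assms(2) by (meson leD order_trans)
  qed
  then have "{\<pi> \<in> bounded_Av132 m n.
     Fin (int n - int (hd \<pi>)) \<le> u \<and> Fin (int n - int (last \<pi>)) \<le> v} = {}" by blast
  then show ?thesis unfolding T_def by (metis card.empty)
qed

end

theory Submission
  imports Defs
begin

text \<open>
  Split \<open>\<pi> = L n R\<close> at its maximum, with \<open>k - 1\<close> the length of \<open>L\<close>. Avoiding \<open>132\<close> means that \<open>L\<close>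
  and \<open>R\<close> avoid it and that every entry of \<open>L\<close> exceeds every entry of \<open>R\<close>, so \<open>R\<close> is a permutation
  of \<open>{1..n-k}\<close> and \<open>L\<close> is one of \<open>{1..k-1}\<close> shifted by \<open>n - k\<close>. If \<open>R\<close> is nonempty, the step from
  \<open>n\<close> to the first entry of \<open>R\<close> is at least \<open>k\<close>; this forces \<open>k \<le> m\<close>, and then the step bound holds
  automatically inside \<open>L n\<close>. If \<open>R\<close> is empty, only the step from the last entry of \<open>L\<close> to \<open>n\<close>
  constrains \<open>L\<close> further.
\<close>

section \<open>The pattern 132 around a maximum\<close>

text \<open>A strict maximum can only play the middle role "3". An occurrence starting in
  \<open>xs\<close> and ending in \<open>ys\<close> yields an ascending pair across
  \<open>x\<close>, and conversely any such pair becomes an occurrence with \<open>x\<close>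
  between.\<close>

lemma contains_132_append_max_iff:
  assumes "\<And>a. a \<in> set xs \<union> set ys \<Longrightarrow> a < x"
  shows "contains_132 (xs @ x # ys) \<longleftrightarrow>
    contains_132 xs \<or> contains_132 ys \<or> (\<exists>a\<in>set xs. \<exists>b\<in>set ys. a < b)"
proof -
  let ?p = "xs @ x # ys" and ?l = "length xs"
  have left: "?p ! i = xs ! i" if "i < ?l" for i
    using that by (simp add: nth_append)
  have right: "?p ! (Suc ?l + i) = ys ! i" for i
    by (simp add: nth_append)
  have le: "?p ! i \<le> x" if "i < length ?p" for i
    using that assms nth_mem[OF that] by (auto simp: less_imp_le)
  show ?thesis
  proof
    assume "contains_132 ?p"
    then obtain i j k where ijk: "i < j" "j < k" "k < length ?p"
      "?p ! i < ?p ! k" "?p ! k < ?p ! j"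
      unfolding contains_132_def by blast
    have "?p ! k < x" using ijk le[of j] by simp
    then have k: "k \<noteq> ?l" and i: "i \<noteq> ?l" using ijk by (auto simp: nth_append)
    \<comment> \<open>The outer positions decide the case. In the second one \<open>j\<close> may
      lie anywhere between them, since only the ascent from \<open>i\<close> to \<open>k\<close>
      matters.\<close>
    consider "k < ?l" | "k > ?l" "i < ?l" | "i > ?l" using k i ijk by linarith
    then show "contains_132 xs \<or> contains_132 ys \<or> (\<exists>a\<in>set xs. \<exists>b\<in>set ys. a < b)"
    proof cases
      case 1
      then have "contains_132 xs"
        unfolding contains_132_def using ijk left by (metis less_trans)
      then show ?thesis ..
    next
      case 2
      then obtain k' where k': "k = Suc ?l + k'" using less_imp_Suc_add by fastforce
      have "?p ! k = ys ! k'" unfolding k' by (rule right)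
      moreover have "k' < length ys" using ijk k' by simp
      ultimately show ?thesis using 2 ijk left[of i] by (metis nth_mem)
    next
      case 3
      define i' j' k' where "i' = i - Suc ?l" and "j' = j - Suc ?l" and "k' = k - Suc ?l"
      have eqs: "i = Suc ?l + i'" "j = Suc ?l + j'" "k = Suc ?l + k'"
        using 3 ijk by (auto simp: i'_def j'_def k'_def)
      have "ys ! i' < ys ! k'" "ys ! k' < ys ! j'"
        using ijk(4,5) unfolding eqs right by auto
      moreover have "i' < j'" "j' < k'" "k' < length ys"
        using ijk(1-3) unfolding eqs by auto
      ultimately have "contains_132 ys"
        unfolding contains_132_def by blast
      then show ?thesis by simp
    qed
  next
    assume "contains_132 xs \<or> contains_132 ys \<or> (\<exists>a\<in>set xs. \<exists>b\<in>set ys. a < b)"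
    then consider "contains_132 xs" | "contains_132 ys"
      | a b where "a \<in> set xs" "b \<in> set ys" "a < b" by blast
    then show "contains_132 ?p"
    proof cases
      case 1
      then obtain i j k where ijk: "i < j" "j < k" "k < ?l"
        "xs ! i < xs ! k" "xs ! k < xs ! j"
        unfolding contains_132_def by blast
      then show ?thesis
        unfolding contains_132_def
        by (intro exI[of _ i] exI[of _ j] exI[of _ k]) (simp add: left)
    next
      case 2
      then obtain i j k where ijk: "i < j" "j < k" "k < length ys"
        "ys ! i < ys ! k" "ys ! k < ys ! j"
        unfolding contains_132_def by blast
      then show ?thesis
        unfolding contains_132_def
        by (intro exI[of _ "Suc ?l + i"] exI[of _ "Suc ?l + j"] exI[of _ "Suc ?l + k"])
          (simp only: right, simp)
    next
      case (3 a b)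
      then obtain i k where "i < ?l" "a = xs ! i" "k < length ys" "b = ys ! k"
        by (metis in_set_conv_nth)
      then have "i < ?l" "?l < Suc ?l + k" "Suc ?l + k < length ?p"
        "?p ! i < ?p ! (Suc ?l + k)" "?p ! (Suc ?l + k) < ?p ! ?l"
        using 3 assms[of b] by (simp_all only: left right) (auto simp: nth_append)
      then show ?thesis unfolding contains_132_def by blast
    qed
  qed
qed

lemma contains_132_map_add [simp]:
  "contains_132 (map (\<lambda>x. x + d) xs) \<longleftrightarrow> contains_132 xs"
proof -
  have "(i < j \<and> j < k \<and> k < length (map (\<lambda>x. x + d) xs) \<and>
      map (\<lambda>x. x + d) xs ! i < map (\<lambda>x. x + d) xs ! k \<and>
      map (\<lambda>x. x + d) xs ! k < map (\<lambda>x. x + d) xs ! j) \<longleftrightarrow>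
    (i < j \<and> j < k \<and> k < length xs \<and> xs ! i < xs ! k \<and> xs ! k < xs ! j)" for i j k
    by auto
  then show ?thesis unfolding contains_132_def by simp
qed

section \<open>Avoiders and the step bound\<close>

lemma Av132_iff:
  "\<pi> \<in> Av132 n \<longleftrightarrow> set \<pi> = {1..n} \<and> distinct \<pi> \<and> \<not> contains_132 \<pi>"
  by (auto simp: Av132_def permutations_of_set_def)

lemma length_Av132: "\<pi> \<in> Av132 n \<Longrightarrow> length \<pi> = n"
  by (metis Av132_iff card_atLeastAtMost diff_Suc_1 distinct_card)

lemma Av132_0 [simp]: "Av132 0 = {[]}"
  by (auto simp: Av132_iff contains_132_def)

lemma finite_Av132 [simp]: "finite (Av132 n)"
  by (simp add: Av132_def)

lemma successively_iff_nth:
  "successively P xs \<longleftrightarrow> (\<forall>i. Suc i < length xs \<longrightarrow> P (xs ! i) (xs ! Suc i))"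
  by (induction P xs rule: successively.induct) (auto simp: less_Suc_eq_0_disj nth_Cons')

lemma successively_if_pairwise:
  "(\<And>x y. x \<in> set xs \<Longrightarrow> y \<in> set xs \<Longrightarrow> P x y) \<Longrightarrow> successively P xs"
  by (simp add: successively_iff_nth)

text \<open>In the \<open>successively\<close> form the step bound splits along \<open>@\<close>,
  which the indexed form does not do directly.\<close>

lemma bounded_Av132_iff_successively:
  "\<pi> \<in> bounded_Av132 m n \<longleftrightarrow>
    \<pi> \<in> Av132 n \<and> successively (\<lambda>x y. \<bar>int y - int x\<bar> \<le> int m) \<pi>"
  by (auto simp: bounded_Av132_def successively_iff_nth length_Av132)

section \<open>Decomposition at the maximum\<close>

text \<open>Here \<open>k\<close> is meant as the position of the maximum counted from 1, and
  \<open>\<sigma>\<close> as the left part standardised to \<open>{1..k-1}\<close>.\<close>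

definition glue_max :: "nat \<Rightarrow> nat \<Rightarrow> nat list \<Rightarrow> nat list \<Rightarrow> nat list" where
  "glue_max n k \<sigma> \<rho> = map (\<lambda>x. x + (n - k)) \<sigma> @ n # \<rho>"

text \<open>Such a set is the interval from 1 to its maximum, which is then its size. So the values
  right of \<open>n\<close> are determined by their number alone.\<close>

lemma downward_closed_eq_atLeastAtMost_card:
  fixes A :: "nat set"
  assumes "finite A" "0 \<notin> A" "\<And>a b. b \<in> A \<Longrightarrow> 1 \<le> a \<Longrightarrow> a < b \<Longrightarrow> a \<in> A"
  shows "A = {1..card A}"
proof (cases "A = {}")
  case False
  then have Max: "Max A \<in> A" using assms(1) by simp
  have "A = {1..Max A}"
  proof (intro equalityI subsetI)
    fix x assume "x \<in> A"
    then have "x \<noteq> 0" "x \<le> Max A" using assms(1,2) by (metis, simp)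
    then show "x \<in> {1..Max A}" by simp
  next
    fix x assume "x \<in> {1..Max A}"
    then show "x \<in> A" using assms(3)[OF Max, of x] Max by (cases "x = Max A") auto
  qed
  then obtain N where "A = {1..N}" ..
  then show ?thesis by simp
qed simp

lemma image_add_diff_atLeastAtMost:
  fixes k n :: nat
  assumes "1 \<le> k" "k \<le> n"
  shows "(\<lambda>x. x + (n - k)) ` {1..k-1} = {n-k+1..n-1}"
proof -
  have "1 + (n - k) = n - k + 1" "k - 1 + (n - k) = n - 1" using assms by auto
  then show ?thesis by (simp only: image_add_atLeastAtMost')
qed

text \<open>The shifted \<open>\<sigma>\<close> fills exactly the gap between the values of
  \<open>\<rho>\<close> and \<open>n\<close>, so no ascending pair crosses the maximum.\<close>

lemma glue_max_in_Av132:
  assumes "1 \<le> k" "k \<le> n" "\<sigma> \<in> Av132 (k - 1)" "\<rho> \<in> Av132 (n - k)"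
  shows "glue_max n k \<sigma> \<rho> \<in> Av132 n"
proof -
  let ?xs = "map (\<lambda>x. x + (n - k)) \<sigma>"
  have \<sigma>: "set \<sigma> = {1..k-1}" "distinct \<sigma>" "\<not> contains_132 \<sigma>"
    and \<rho>: "set \<rho> = {1..n-k}" "distinct \<rho>" "\<not> contains_132 \<rho>"
    using assms by (auto simp: Av132_iff)
  have "set ?xs = (\<lambda>x. x + (n - k)) ` {1..k-1}" using \<sigma> by simp
  also have "\<dots> = {n-k+1..n-1}" using assms(1,2) by (rule image_add_diff_atLeastAtMost)
  finally have xs: "set ?xs = {n-k+1..n-1}" .
  have "distinct ?xs" using \<sigma>(2) by (simp add: distinct_map inj_on_def)
  then have "distinct (?xs @ n # \<rho>)" using xs \<rho> assms(1,2) by auto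
  moreover have "set (?xs @ n # \<rho>) = {1..n}"
    unfolding set_append list.set xs \<rho>(1) using assms(1,2) by auto
  moreover have "\<not> contains_132 (?xs @ n # \<rho>)"
  proof (subst contains_132_append_max_iff)
    show "a < n" if "a \<in> set ?xs \<union> set \<rho>" for a
      using that assms(1,2) unfolding xs \<rho>(1) by auto
    have "\<not> a < b" if "a \<in> set ?xs" "b \<in> set \<rho>" for a b
      using that unfolding xs \<rho>(1) by auto
    then show "\<not> (contains_132 ?xs \<or> contains_132 \<rho> \<or> (\<exists>a\<in>set ?xs. \<exists>b\<in>set \<rho>. a < b))"
      using \<sigma>(3) \<rho>(3) by (metis contains_132_map_add)
  qed
  ultimately show ?thesis by (simp add: Av132_iff glue_max_def)
qed

lemma Av132_obtain_glue_max:
  assumes "\<pi> \<in> Av132 n" "1 \<le> n"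
  obtains k \<sigma> \<rho> where "k \<in> {1..n}" "\<sigma> \<in> Av132 (k - 1)" "\<rho> \<in> Av132 (n - k)"
    "\<pi> = glue_max n k \<sigma> \<rho>"
proof -
  have \<pi>: "set \<pi> = {1..n}" "distinct \<pi>" "\<not> contains_132 \<pi>" "length \<pi> = n"
    using assms by (auto simp: Av132_iff length_Av132)
  then have "n \<in> set \<pi>" using assms by simp
  then obtain xs ys where split: "\<pi> = xs @ n # ys" by (meson split_list)
  have disj: "n \<notin> set xs" "n \<notin> set ys" "set xs \<inter> set ys = {}" "distinct xs" "distinct ys"
    using \<pi>(2) split by auto
  have un: "insert n (set xs \<union> set ys) = {1..n}" using \<pi>(1) split by auto
  then have "set xs \<union> set ys = {1..n} - {n}" using disj(1,2) by blast
  also have "\<dots> = {1..n-1}" by auto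
  finally have un': "set xs \<union> set ys = {1..n-1}" .
  then have less: "a < n" if "a \<in> set xs \<union> set ys" for a using that assms(2) by auto
  have "\<not> (contains_132 xs \<or> contains_132 ys \<or> (\<exists>a\<in>set xs. \<exists>b\<in>set ys. a < b))"
    using \<pi>(3) contains_132_append_max_iff[OF less] unfolding split by blast
  then have av: "\<not> contains_132 xs" "\<not> contains_132 ys"
    and cross: "\<And>a b. a \<in> set xs \<Longrightarrow> b \<in> set ys \<Longrightarrow> \<not> a < b"
    by blast+
  define k where "k = Suc (length xs)"
  have k: "k \<in> {1..n}" "length ys = n - k" using \<pi>(4) split by (auto simp: k_def)
  \<comment> \<open>A missing value below some \<open>b\<close> in \<open>ys\<close> would lie in
    \<open>xs\<close> and ascend to \<open>b\<close> across the maximum.\<close>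
  have "set ys = {1..card (set ys)}"
  proof (rule downward_closed_eq_atLeastAtMost_card)
    have ys_sub: "set ys \<subseteq> {1..n-1}" using un' by blast
    then show "0 \<notin> set ys" by auto
    fix a b assume b: "b \<in> set ys" "1 \<le> a" "a < b"
    then have "b \<le> n - 1" using ys_sub by auto
    then have "a \<in> set xs \<union> set ys" unfolding un' using b by auto
    then show "a \<in> set ys" using cross b by auto
  qed simp
  then have ys: "set ys = {1..n-k}" unfolding distinct_card[OF disj(5)] k(2) .
  have "set xs = {1..n-1} - {1..n-k}" using un' ys disj(3) by blast
  also have "\<dots> = {n-k+1..n-1}" by auto
  finally have xs: "set xs = {n-k+1..n-1}" .
  \<comment> \<open>All entries of \<open>xs\<close> exceed \<open>n - k\<close>, so the subtraction
    never truncates and shifting back restores \<open>xs\<close>.\<close>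
  define \<sigma> where "\<sigma> = map (\<lambda>x. x - (n - k)) xs"
  have xs_eq: "map (\<lambda>x. x + (n - k)) \<sigma> = xs"
    unfolding \<sigma>_def map_map by (rule map_idI) (use xs in auto)
  have "(\<lambda>x. x + (n - k)) ` set \<sigma> = {n-k+1..n-1}"
    unfolding set_map[symmetric] xs_eq by (rule xs)
  also have "\<dots> = (\<lambda>x. x + (n - k)) ` {1..k-1}"
    using k(1) by (intro image_add_diff_atLeastAtMost[symmetric]) auto
  finally have "set \<sigma> = {1..k-1}"
    by (rule inj_image_eq_iff[THEN iffD1, rotated]) (simp add: inj_def)
  moreover have "distinct \<sigma>" using disj(4) xs_eq by (metis distinct_map)
  moreover have "\<not> contains_132 \<sigma>" using av(1) xs_eq by (metis contains_132_map_add)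
  ultimately have "\<sigma> \<in> Av132 (k - 1)" by (simp add: Av132_iff)
  moreover have "ys \<in> Av132 (n - k)" using ys av disj by (simp add: Av132_iff)
  moreover have "\<pi> = glue_max n k \<sigma> ys" unfolding glue_max_def xs_eq by (rule split)
  ultimately show ?thesis using that k(1) by blast
qed

text \<open>Neither piece contains \<open>n\<close>, so its unique occurrence marks the cut. The
  length of \<open>\<rho>\<close> then recovers \<open>k\<close>. This provides both injectivity and
  disjointness for the count.\<close>

lemma glue_max_eq_iff:
  assumes "k \<in> {1..n}" "\<sigma> \<in> Av132 (k - 1)" "\<rho> \<in> Av132 (n - k)"
    and "k' \<in> {1..n}" "\<sigma>' \<in> Av132 (k' - 1)" "\<rho>' \<in> Av132 (n - k')"
  shows "glue_max n k \<sigma> \<rho> = glue_max n k' \<sigma>' \<rho>' \<longleftrightarrow> k = k' \<and> \<sigma> = \<sigma>' \<and> \<rho> = \<rho>'"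
proof
  assume eq: "glue_max n k \<sigma> \<rho> = glue_max n k' \<sigma>' \<rho>'"
  have notin: "n \<notin> set (map (\<lambda>x. x + (n - j)) \<tau>)" "n \<notin> set \<upsilon>"
    if "j \<in> {1..n}" "\<tau> \<in> Av132 (j - 1)" "\<upsilon> \<in> Av132 (n - j)" for j \<tau> \<upsilon>
    using that by (auto simp: Av132_iff)
  have *: "map (\<lambda>x. x + (n - k)) \<sigma> = map (\<lambda>x. x + (n - k')) \<sigma>'" "\<rho> = \<rho>'"
    using eq notin[OF assms(1-3)] notin[OF assms(4-6)]
    unfolding glue_max_def by (simp_all add: append_Cons_eq_iff)
  then have "n - k = n - k'" using assms(3,6) length_Av132 by metis
  then have "k = k'" using assms(1,4) by auto
  moreover from this have "\<sigma> = \<sigma>'" using *(1) by (simp add: inj_map_eq_map)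
  ultimately show "k = k' \<and> \<sigma> = \<sigma>' \<and> \<rho> = \<rho>'" using * by simp
qed simp

section \<open>Step bound and thresholds under gluing\<close>

text \<open>With \<open>\<rho>\<close> nonempty, the step \<open>n - hd \<rho> \<le> m\<close> is
  measured from the top value \<open>n - k\<close> of \<open>\<rho>\<close>, which turns it into the
  starting threshold \<open>m - k\<close>.\<close>

lemma successively_glue_max_iff:
  assumes "1 \<le> k" "k < n" "\<sigma> \<in> Av132 (k - 1)" "\<rho> \<in> Av132 (n - k)"
  shows "successively (\<lambda>x y. \<bar>int y - int x\<bar> \<le> int m) (glue_max n k \<sigma> \<rho>) \<longleftrightarrow>
    k \<le> m \<and> successively (\<lambda>x y. \<bar>int y - int x\<bar> \<le> int m) \<rho> \<and>
    int (n - k) - int (hd \<rho>) \<le> int m - int k"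
proof -
  let ?P = "\<lambda>x y. \<bar>int y - int x\<bar> \<le> int m"
  let ?xs = "map (\<lambda>x. x + (n - k)) \<sigma>"
  have \<rho>: "set \<rho> = {1..n-k}" and \<sigma>: "set \<sigma> = {1..k-1}" using assms by (auto simp: Av132_iff)
  have ne: "\<rho> \<noteq> []" using \<rho> assms(2) by auto
  then have hd: "1 \<le> hd \<rho>" "hd \<rho> \<le> n - k" using hd_in_set[OF ne] unfolding \<rho> by auto
  \<comment> \<open>All these entries lie between \<open>n - k\<close> and \<open>n\<close>, so any
    two of them, adjacent or not, differ by at most \<open>k\<close>.\<close>
  have "successively ?P (?xs @ [n])" if "k \<le> m"
  proof (rule successively_if_pairwise)
    fix x y assume "x \<in> set (?xs @ [n])" "y \<in> set (?xs @ [n])"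
    then have "n - k \<le> x \<and> x \<le> n" "n - k \<le> y \<and> y \<le> n"
      using \<sigma> assms(1,2) by auto
    then show "?P x y" using that assms(2) by auto
  qed
  moreover have "successively ?P (glue_max n k \<sigma> \<rho>) \<longleftrightarrow>
      successively ?P (?xs @ [n]) \<and> successively ?P \<rho> \<and> ?P n (hd \<rho>)"
    using ne successively_append_iff[of ?P "?xs @ [n]" \<rho>] by (simp add: glue_max_def)
  moreover have "?P n (hd \<rho>) \<longleftrightarrow> k \<le> m \<and> int (n - k) - int (hd \<rho>) \<le> int m - int k"
    using hd assms(2) by auto
  ultimately show ?thesis by argo
qed

text \<open>Infinite thresholds absorb finite shifts, so the convention
  \<open>\<infinity> - r = \<infinity>\<close> needs no separate treatment later.\<close>

lemma Fin_le_minus_Fin_iff: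
  fixes a b :: int
  shows "Fin a \<le> q - Fin b \<longleftrightarrow> Fin (a + b) \<le> q"
  by (cases q) auto

lemma B_nonneg: "q \<in> B m \<Longrightarrow> Fin 0 \<le> q"
  by (auto simp: B_def)

definition T_set :: "nat \<Rightarrow> int extended \<Rightarrow> int extended \<Rightarrow> nat \<Rightarrow> nat list set" where
  "T_set m u v n = {\<pi> \<in> bounded_Av132 m n.
     Fin (int n - int (hd \<pi>)) \<le> u \<and> Fin (int n - int (last \<pi>)) \<le> v}"

text \<open>The disjunct \<open>k = 1\<close> covers the empty left part, where
  \<open>hd \<sigma>\<close> is unspecified, and matches the convention that \<open>c\<close> is 1
  there.\<close>

definition c_set :: "nat \<Rightarrow> int extended \<Rightarrow> nat list set" where
  "c_set k p = {\<sigma> \<in> Av132 (k - 1). k = 1 \<or> Fin (int k - int (hd \<sigma>)) \<le> p}"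

lemma card_c_set: "card (c_set k p) = c k p"
proof (cases "k = 1")
  case True
  then have "c_set k p = {[]}" by (auto simp: c_set_def)
  then show ?thesis using True by (simp add: c_def)
qed (simp add: c_set_def c_def)

lemma T_set_subset_Av132: "T_set m u v n \<subseteq> Av132 n"
  by (auto simp: T_set_def bounded_Av132_def)

lemma finite_T_set: "finite (T_set m u v n)"
  by (rule finite_subset[OF T_set_subset_Av132 finite_Av132])

lemma finite_c_set: "finite (c_set k p)"
  by (simp add: c_set_def)

text \<open>The shift by \<open>n - k\<close> turns the distance of the first entry from
  \<open>n\<close> into \<open>k - hd \<sigma>\<close>, the quantity in \<open>c\<close>. The last
  entry belongs to \<open>\<rho>\<close>, whose top value is lower by \<open>k\<close>, hence
  \<open>q - k\<close>.\<close>

lemma glue_max_in_T_set_iff: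
  assumes "q \<in> B m" "p \<in> B m" "1 \<le> k" "k < n" "\<sigma> \<in> Av132 (k - 1)" "\<rho> \<in> Av132 (n - k)"
  shows "glue_max n k \<sigma> \<rho> \<in> T_set m p q n \<longleftrightarrow>
    k \<le> m \<and> \<sigma> \<in> c_set k p \<and> \<rho> \<in> T_set m (Fin (int m - int k)) (q - Fin (int k)) (n - k)"
proof -
  have ne: "\<rho> \<noteq> []" using assms(4) length_Av132[OF assms(6)] by auto
  have "Fin (int n - int (hd (glue_max n k \<sigma> \<rho>))) \<le> p \<longleftrightarrow> k = 1 \<or> Fin (int k - int (hd \<sigma>)) \<le> p"
  proof (cases "k = 1")
    case True
    \<comment> \<open>The permutation starts with \<open>n\<close> itself: distance 0 passes every
      threshold in \<open>B m\<close>.\<close>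
    then show ?thesis using assms(5) B_nonneg[OF assms(2)] by (simp add: glue_max_def)
  next
    case False
    then have "\<sigma> \<noteq> []" using assms(3) length_Av132[OF assms(5)] by auto
    then have "int n - int (hd (glue_max n k \<sigma> \<rho>)) = int k - int (hd \<sigma>)"
      using assms(4) by (simp add: glue_max_def hd_map)
    then show ?thesis using False by simp
  qed
  moreover have "Fin (int n - int (last (glue_max n k \<sigma> \<rho>))) \<le> q \<longleftrightarrow>
      Fin (int (n - k) - int (last \<rho>)) \<le> q - Fin (int k)"
    using ne assms(4) by (simp add: glue_max_def Fin_le_minus_Fin_iff)
  moreover have "glue_max n k \<sigma> \<rho> \<in> Av132 n" using assms by (intro glue_max_in_Av132) auto
  ultimately show ?thesis
    unfolding T_set_def c_set_def
    using assms successively_glue_max_iff[OF assms(3-6), of m]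
    by (auto simp: bounded_Av132_iff_successively)
qed

text \<open>Ending in \<open>n\<close> satisfies every \<open>q\<close> in \<open>B m\<close>.
  Lowering the top value from \<open>n\<close> to \<open>n - 1\<close> turns \<open>p\<close> into
  \<open>p - 1\<close>, and the final step up to \<open>n\<close> becomes the end threshold
  \<open>m - 1\<close>.\<close>

lemma glue_max_Nil_in_T_set_iff:
  assumes "q \<in> B m" "2 \<le> n" "\<sigma> \<in> Av132 (n - 1)"
  shows "glue_max n n \<sigma> [] \<in> T_set m p q n \<longleftrightarrow>
    \<sigma> \<in> T_set m (p - Fin 1) (Fin (int m - 1)) (n - 1)"
proof -
  let ?P = "\<lambda>x y. \<bar>int y - int x\<bar> \<le> int m"
  have ne: "\<sigma> \<noteq> []" using assms(2) length_Av132[OF assms(3)] by auto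
  have glue: "glue_max n n \<sigma> [] = \<sigma> @ [n]" by (simp add: glue_max_def)
  have "\<sigma> @ [n] \<in> Av132 n"
    using glue_max_in_Av132[of n n \<sigma> "[]"] assms by (simp add: glue)
  moreover have "last \<sigma> \<le> n - 1"
    using last_in_set[OF ne] assms(3) by (auto simp: Av132_iff)
  then have "?P (last \<sigma>) n \<longleftrightarrow> int (n - 1) - int (last \<sigma>) \<le> int m - 1"
    using assms(2) by auto
  then have "successively ?P (\<sigma> @ [n]) \<longleftrightarrow>
      successively ?P \<sigma> \<and> int (n - 1) - int (last \<sigma>) \<le> int m - 1"
    using ne by (simp add: successively_append_iff)
  moreover have "Fin (int n - int (hd \<sigma>)) \<le> p \<longleftrightarrow> Fin (int (n - 1) - int (hd \<sigma>)) \<le> p - Fin 1"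
    using assms(2) by (simp add: Fin_le_minus_Fin_iff)
  ultimately show ?thesis
    using ne assms(3) B_nonneg[OF assms(1)]
    by (auto simp: glue T_set_def bounded_Av132_iff_successively)
qed

section \<open>Counting over the position of the maximum\<close>

lemma T_recurrence:
  assumes "2 \<le> n" "p \<in> B m" "q \<in> B m"
  shows "T m p q n =
    (\<Sum>k = 1..min m (n - 1). c k p * T m (Fin (int m - int k)) (q - Fin (int k)) (n - k))
    + T m (p - Fin 1) (Fin (int m - 1)) (n - 1)"
proof -
  define G where "G k = (\<lambda>(\<sigma>, \<rho>). glue_max n k \<sigma> \<rho>)" for k
  \<comment> \<open>Admissible pairs of pieces for each position; the singleton keeps the case
    \<open>k = n\<close> in the same product shape.\<close>
  define D where "D k = (if k = n then T_set m (p - Fin 1) (Fin (int m - 1)) (n - 1) \<times> {[]}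
    else c_set k p \<times> T_set m (Fin (int m - int k)) (q - Fin (int k)) (n - k))" for k
  \<comment> \<open>Positions strictly between \<open>m\<close> and \<open>n\<close> admit no
    permutation, because the step down from \<open>n\<close> would be too large.\<close>
  define K where "K = insert n {1..min m (n - 1)}"
  have D_sub: "D k \<subseteq> Av132 (k - 1) \<times> Av132 (n - k)" if "k \<in> K" for k
    unfolding D_def by (auto simp: c_set_def intro: subsetD[OF T_set_subset_Av132])
  have K: "k \<in> {1..n}" if "k \<in> K" for k using that assms(1) by (auto simp: K_def)
  have G_eqD: "k = k' \<and> x = x'"
    if "k \<in> K" "k' \<in> K" "x \<in> D k" "x' \<in> D k'" "G k x = G k' x'" for k k' x x'
  proof -
    obtain \<sigma> \<rho> \<sigma>' \<rho>' where x: "x = (\<sigma>, \<rho>)" "x' = (\<sigma>', \<rho>')" by fastforce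
    have "\<sigma> \<in> Av132 (k - 1)" "\<rho> \<in> Av132 (n - k)" "\<sigma>' \<in> Av132 (k' - 1)" "\<rho>' \<in> Av132 (n - k')"
      using D_sub that(1-4) x by blast+
    then show ?thesis
      using glue_max_eq_iff[of k n \<sigma> \<rho> k' \<sigma>' \<rho>'] K that(1,2,5) x by (simp add: G_def)
  qed
  have inj: "inj_on (G k) (D k)" if "k \<in> K" for k
    using G_eqD[OF that that] by (auto intro: inj_onI)
  have disj: "G k ` D k \<inter> G k' ` D k' = {}" if "k \<in> K" "k' \<in> K" "k \<noteq> k'" for k k'
    using G_eqD[OF that(1,2)] that(3) by blast
  have finD: "finite (D k)" for k by (simp add: D_def finite_T_set finite_c_set)
  have "T_set m p q n = (\<Union>k\<in>K. G k ` D k)"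
  proof (intro equalityI subsetI)
    fix \<pi> assume \<pi>: "\<pi> \<in> T_set m p q n"
    then have "\<pi> \<in> Av132 n" using T_set_subset_Av132 by blast
    then obtain k \<sigma> \<rho> where k: "k \<in> {1..n}" "\<sigma> \<in> Av132 (k - 1)" "\<rho> \<in> Av132 (n - k)"
      "\<pi> = glue_max n k \<sigma> \<rho>" using Av132_obtain_glue_max assms(1) by (metis One_nat_def Suc_1 Suc_leD)
    have "k \<in> K \<and> (\<sigma>, \<rho>) \<in> D k"
    proof (cases "k = n")
      case True
      then show ?thesis using k \<pi> glue_max_Nil_in_T_set_iff[OF assms(3,1)]
        by (auto simp: K_def D_def)
    next
      case False
      then show ?thesis using k \<pi> glue_max_in_T_set_iff[OF assms(3,2), of k n \<sigma> \<rho>]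
        by (auto simp: K_def D_def)
    qed
    then show "\<pi> \<in> (\<Union>k\<in>K. G k ` D k)" using k(4) by (force simp: G_def)
  next
    fix \<pi> assume "\<pi> \<in> (\<Union>k\<in>K. G k ` D k)"
    then obtain k \<sigma> \<rho> where k: "k \<in> K" "(\<sigma>, \<rho>) \<in> D k" "\<pi> = glue_max n k \<sigma> \<rho>"
      by (auto simp: G_def)
    then have av: "\<sigma> \<in> Av132 (k - 1)" "\<rho> \<in> Av132 (n - k)" using D_sub by auto
    show "\<pi> \<in> T_set m p q n"
    proof (cases "k = n")
      case True
      then show ?thesis using k av glue_max_Nil_in_T_set_iff[OF assms(3,1)]
        by (auto simp: D_def)
    next
      case False
      then show ?thesis using k av K[OF k(1)] glue_max_in_T_set_iff[OF assms(3,2), of k n \<sigma> \<rho>]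
        by (auto simp: K_def D_def)
    qed
  qed
  then have "T m p q n = card (\<Union>k\<in>K. G k ` D k)" by (simp add: T_def T_set_def)
  also have "\<dots> = (\<Sum>k\<in>K. card (G k ` D k))"
    using disj finD by (intro card_UN_disjoint) (auto simp: K_def)
  also have "\<dots> = (\<Sum>k\<in>K. card (D k))"
    by (intro sum.cong refl card_image inj)
  also have "\<dots> = (\<Sum>k = 1..min m (n - 1). card (D k)) + card (D n)"
    \<comment> \<open>Since \<open>n\<close> lies outside the range of the sum, its block splits off
      as the last term of the recurrence.\<close>
    unfolding K_def using assms(1) by (subst sum.insert) auto
  also have "(\<Sum>k = 1..min m (n - 1). card (D k)) = (\<Sum>k = 1..min m (n - 1).
      c k p * T m (Fin (int m - int k)) (q - Fin (int k)) (n - k))"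
    using assms(1)
    by (intro sum.cong refl) (auto simp: D_def card_cartesian_product card_c_set T_def T_set_def)
  also have "card (D n) = T m (p - Fin 1) (Fin (int m - 1)) (n - 1)"
    by (simp add: D_def card_cartesian_product T_def T_set_def)
  finally show ?thesis .
qed

theorem theorem2p4:
  fixes m :: nat
  assumes "m \<ge> 1"
  shows "(\<forall>n\<ge>2. \<forall>p\<in>B m. \<forall>q\<in>B m.
            T m p q n =
              (\<Sum>k = 1..min m (n - 1). c k p * T m (Fin (int m - int k)) (q - Fin (int k)) (n - k))
              + T m (p - Fin 1) (Fin (int m - 1)) (n - 1))
       \<and> (\<forall>n\<ge>m + 1. \<forall>p\<in>B m. \<forall>q\<in>B m.
            T m p q n =
              (\<Sum>k = 1..m. c k p * T m (Fin (int m - int k)) (q - Fin (int k)) (n - k))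
              + T m (p - Fin 1) (Fin (int m - 1)) (n - 1))"
proof (intro conjI allI impI ballI)
  fix n p q assume "m + 1 \<le> n" "p \<in> B m" "q \<in> B m"
  \<comment> \<open>Here \<open>m \<ge> 1\<close> lifts \<open>n \<ge> m + 1\<close> to the bound
    \<open>n \<ge> 2\<close> of the recurrence.\<close>
  moreover from this have "2 \<le> n" "min m (n - 1) = m" using assms by auto
  ultimately show "T m p q n =
      (\<Sum>k = 1..m. c k p * T m (Fin (int m - int k)) (q - Fin (int k)) (n - k))
      + T m (p - Fin 1) (Fin (int m - 1)) (n - 1)"
    using T_recurrence[of n p m q] by simp
qed (rule T_recurrence)

end
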